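(* Let $X=[0,1]$, let $A=C(X,\mathbb K)$, let $\{t_i\}_{i\in\mathbb N}$ be a countable dense subset of $X$, and let $J=\{x\in A: fx\in A\}$, where $f:X\to\mathbb K$ is given by $f(t)=\sum_{i\in\mathbb N}\frac{1}{2^i}\chi_{[0,t_i]}(t)p_i$. Then the closed right ideal $J$ of $A$ is thick.
   Context: $H$ is a separable infinite-dimensional Hilbert space with a fixed orthonormal basis $\{e_i\}_{i\in\mathbb N}$ ($\mathbb N=\{1,2,\dots\}$), $\mathbb K$ is the $C^*$-algebra of compact operators on $H$, and $C(X,\mathbb K)$ is the $C^*$-algebra of norm-continuous $\mathbb K$-valued functions on $X$ with pointwise operations. $p_i$ is the rank one projection onto the span of $e_i$, and $\chi_E$ is the characteristic function of $E\subset X$. The product $fx$ is the pointwise product, $(fx)(t)=f(t)x(t)$; so $J$ consists of those $x\in A$ for which the function $fx$ is continuous, and it is a closed right ideal in $A$. A closed right ideal $J$ of a $C^*$-algebra $A$ is called thick if, for $a\in A$, $aJ=0$ (i.e. $ax=0$ for all $x\in J$) implies $a=0$. *)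

theory Defs
  imports "HOL-Analysis.Analysis"
begin

text \<open>Complex Hilbert spaces. The real inner product, and with it the norm and the topology, is
  the one underlying the complex inner product, which is linear in its first argument.\<close>

class complex_inner = real_inner +
  fixes scaleC :: "complex \<Rightarrow> 'a \<Rightarrow> 'a" (infixr \<open>*\<^sub>C\<close> 75)
    and cinner :: "'a \<Rightarrow> 'a \<Rightarrow> complex"
  assumes scaleC_add_right: "c *\<^sub>C (x + y) = c *\<^sub>C x + c *\<^sub>C y"
    and scaleC_add_left: "(c + d) *\<^sub>C x = c *\<^sub>C x + d *\<^sub>C x"
    and scaleC_scaleC: "c *\<^sub>C d *\<^sub>C x = (c * d) *\<^sub>C x"
    and scaleC_one: "1 *\<^sub>C x = x"
    and scaleR_eq_scaleC: "r *\<^sub>R x = complex_of_real r *\<^sub>C x"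
    and cinner_commute: "cinner x y = cnj (cinner y x)"
    and cinner_add_left: "cinner (x + y) z = cinner x z + cinner y z"
    and cinner_scaleC_left: "cinner (c *\<^sub>C x) y = c * cinner x y"
    and inner_eq_Re_cinner: "inner x y = Re (cinner x y)"

class complex_hilbert = complex_inner + banach

global_interpretation complex_vector: vector_space "scaleC :: complex \<Rightarrow> 'a \<Rightarrow> 'a::complex_inner"
  defines cspan = complex_vector.span
  by unfold_locales (simp_all add: scaleC_add_right scaleC_add_left scaleC_scaleC scaleC_one)

definition orthonormal_basis :: "('i \<Rightarrow> 'h::complex_hilbert) \<Rightarrow> 'i set \<Rightarrow> bool" where
  "orthonormal_basis e I \<longleftrightarrow>
    (\<forall>i\<in>I. \<forall>j\<in>I. cinner (e i) (e j) = (if i = j then 1 else 0)) \<and>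
    closure (cspan (e ` I)) = UNIV"

lemma norm_scaleC: "norm (c *\<^sub>C x) = cmod c * norm (x::'a::complex_inner)"
proof -
  have im: "Im (cinner x x) = 0"
    using cinner_commute[of x x] by (metis cnj.simps(2) neg_equal_zero)
  have "cinner (c *\<^sub>C x) (c *\<^sub>C x) = c * cnj c * cinner x x"
    by (metis (no_types, lifting) cinner_commute cinner_scaleC_left complex_cnj_mult mult.assoc)
  also have "\<dots> = complex_of_real ((cmod c)\<^sup>2) * cinner x x"
    by (simp only: complex_norm_square)
  finally have "(norm (c *\<^sub>C x))\<^sup>2 = (cmod c * norm x)\<^sup>2"
    by (simp add: power2_norm_eq_inner inner_eq_Re_cinner power_mult_distrib im)
  then show ?thesis by simp
qed

lemma cmod_cinner_le: "cmod (cinner x y) \<le> norm x * norm (y::'a::complex_inner)"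
proof (cases "cinner x y = 0")
  case False
  define c where "c = cnj (cinner x y) / cmod (cinner x y)"
  have c: "cmod c = 1" using False by (simp add: c_def norm_divide)
  have "c * cinner x y = cmod (cinner x y)"
    using False complex_norm_square[of "cinner x y"]
    by (simp add: c_def power2_eq_square field_simps)
  then have "cmod (cinner x y) = inner (c *\<^sub>C x) y"
    by (simp add: inner_eq_Re_cinner cinner_scaleC_left)
  also have "\<dots> \<le> norm (c *\<^sub>C x) * norm y" by (rule norm_cauchy_schwarz)
  finally show ?thesis by (simp add: norm_scaleC c)
qed simp

text \<open>For a unit vector \<open>u\<close> this is the orthogonal projection onto the line spanned by \<open>u\<close>.\<close>

lift_definition rank_one_proj :: "'h \<Rightarrow> 'h \<Rightarrow>\<^sub>L 'h::complex_hilbert" is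
  "\<lambda>u x. cinner x u *\<^sub>C u"
proof (rule bounded_linear_intro)
  fix u x y :: 'h and r :: real
  show "cinner (x + y) u *\<^sub>C u = cinner x u *\<^sub>C u + cinner y u *\<^sub>C u"
    by (simp add: cinner_add_left scaleC_add_left)
  show "cinner (r *\<^sub>R x) u *\<^sub>C u = r *\<^sub>R (cinner x u *\<^sub>C u)"
    by (simp add: scaleR_eq_scaleC cinner_scaleC_left scaleC_scaleC)
  show "norm (cinner x u *\<^sub>C u) \<le> norm x * (norm u * norm u)"
    using mult_right_mono[OF cmod_cinner_le[of x u], of "norm u"]
    by (simp add: norm_scaleC mult.assoc)
qed

text \<open>The elements of \<open>'h \<Rightarrow>\<^sub>L 'h\<close> are the bounded real-linear operators, with the operator norm;
  complex homogeneity therefore has to be required separately.\<close>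

definition compact_operators :: "('h::complex_hilbert \<Rightarrow>\<^sub>L 'h) set" where
  "compact_operators = {T. (\<forall>c x. blinfun_apply T (c *\<^sub>C x) = c *\<^sub>C blinfun_apply T x) \<and>
     compact (closure (blinfun_apply T ` cball 0 1))}"

text \<open>The part of the structure of a \<open>C\<^sup>*\<close>-algebra that closed right ideals and thickness refer to;
  the algebra need not have a unit, and the involution plays no role.\<close>

record 'a normed_alg =
  elems :: "'a set"
  zero_of :: 'a
  add_of :: "'a \<Rightarrow> 'a \<Rightarrow> 'a"
  scale_of :: "complex \<Rightarrow> 'a \<Rightarrow> 'a"
  mult_of :: "'a \<Rightarrow> 'a \<Rightarrow> 'a"
  norm_of :: "'a \<Rightarrow> real"

definition right_ideal :: "('a, 'm) normed_alg_scheme \<Rightarrow> 'a set \<Rightarrow> bool" where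
  "right_ideal A J \<longleftrightarrow> J \<subseteq> elems A \<and> zero_of A \<in> J \<and>
    (\<forall>x\<in>J. \<forall>y\<in>J. add_of A x y \<in> J) \<and>
    (\<forall>c. \<forall>x\<in>J. scale_of A c x \<in> J) \<and>
    (\<forall>x\<in>J. \<forall>a\<in>elems A. mult_of A x a \<in> J)"

definition norm_closed :: "('a, 'm) normed_alg_scheme \<Rightarrow> 'a set \<Rightarrow> bool" where
  "norm_closed A J \<longleftrightarrow>
    (\<forall>a\<in>elems A. (\<forall>\<epsilon>>0. \<exists>x\<in>J. norm_of A (add_of A a (scale_of A (-1) x)) < \<epsilon>) \<longrightarrow> a \<in> J)"

definition closed_right_ideal :: "('a, 'm) normed_alg_scheme \<Rightarrow> 'a set \<Rightarrow> bool" where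
  "closed_right_ideal A J \<longleftrightarrow> right_ideal A J \<and> norm_closed A J"

definition thick :: "('a, 'm) normed_alg_scheme \<Rightarrow> 'a set \<Rightarrow> bool" where
  "thick A J \<longleftrightarrow> closed_right_ideal A J \<and>
    (\<forall>a\<in>elems A. (\<forall>x\<in>J. mult_of A a x = zero_of A) \<longrightarrow> a = zero_of A)"

text \<open>The algebra \<open>C(X, K)\<close> for a compact set \<open>X\<close>. A function on \<open>X\<close> is represented by its extension
  by \<open>0\<close> to the whole type, so that equality of elements is equality of functions on \<open>X\<close>.
  Complex multiples of an operator are formed by composing with scalar multiplication on the
  Hilbert space.\<close>

lift_definition scaleC_op :: "complex \<Rightarrow> ('h \<Rightarrow>\<^sub>L 'h) \<Rightarrow> 'h \<Rightarrow>\<^sub>L 'h::complex_hilbert" is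
  "\<lambda>c T x. c *\<^sub>C T x"
proof -
  fix c :: complex and T :: "'h \<Rightarrow> 'h"
  assume T: "bounded_linear T"
  have "bounded_linear (\<lambda>x::'h. c *\<^sub>C x)"
    by (rule bounded_linear_intro[where K = "cmod c"])
      (simp_all add: scaleC_add_right scaleR_eq_scaleC scaleC_scaleC norm_scaleC mult.commute)
  then show "bounded_linear (\<lambda>x. c *\<^sub>C T x)"
    using T by (rule bounded_linear_compose)
qed

definition cont_compact_ops ::
    "'x::topological_space set \<Rightarrow> ('x \<Rightarrow> 'h::complex_hilbert \<Rightarrow>\<^sub>L 'h) normed_alg" where
  "cont_compact_ops X = \<lparr>
     elems = {a. continuous_on X a \<and> (\<forall>s\<in>X. a s \<in> compact_operators) \<and> (\<forall>s. s \<notin> X \<longrightarrow> a s = 0)},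
     zero_of = (\<lambda>s. 0),
     add_of = (\<lambda>a b s. a s + b s),
     scale_of = (\<lambda>c a s. scaleC_op c (a s)),
     mult_of = (\<lambda>a b s. a s o\<^sub>L b s),
     norm_of = (\<lambda>a. SUP s\<in>X. norm (a s)) \<rparr>"

end

theory Submission
  imports Defs
begin

text \<open>
  A function \<open>x\<close> in \<open>A\<close> lies in \<open>J\<close> as soon as it kills the jumps of \<open>f\<close>. The values of \<open>f\<close> are
  diagonal operators, and the \<open>i\<close>-th diagonal entry of \<open>f\<close> jumps only at \<open>t\<^sub>i\<close>; hence
  \<open>x(s) = (s - t\<^sub>i) p\<^sub>i\<close> is in \<open>J\<close>, because \<open>f(s) x(s) = 2\<^sup>-\<^sup>i min(s - t\<^sub>i, 0) p\<^sub>i\<close> on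
  \<open>[0,1]\<close> is continuous. If \<open>a J = 0\<close>, then
  \<open>(s - t\<^sub>i) a(s) e\<^sub>i = 0\<close> for all \<open>s\<close>, so \<open>a(s) e\<^sub>i\<close> vanishes off the single point \<open>t\<^sub>i\<close>, and by
  continuity it vanishes at \<open>t\<^sub>i\<close> as well. Thus every \<open>a(s)\<close> kills the orthonormal basis, and \<open>a = 0\<close>.

  That \<open>J\<close> is a closed right ideal holds for every bounded \<open>f\<close> with complex-linear values
  (\<open>multiplier_closed_right_ideal\<close>): the ideal properties are those of pointwise multiplication, and
  \<open>J\<close> is closed because left multiplication by a bounded function preserves uniform limits.
  That \<open>f\<close> has these properties, and acts diagonally, comes from the absolute convergence of its
  series in operator norm (\<open>complex_linear_diagonal_op\<close>,
  \<open>norm_diagonal_op_le\<close>, \<open>diagonal_op_apply_basis\<close>).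
\<close>

section \<open>Compact operators\<close>

definition complex_linear :: "('h::complex_hilbert \<Rightarrow>\<^sub>L 'h) \<Rightarrow> bool" where
  "complex_linear T \<longleftrightarrow> (\<forall>c x. T (c *\<^sub>C x) = c *\<^sub>C T x)"

lemma scaleC_scaleR_commute: "c *\<^sub>C (r *\<^sub>R x) = r *\<^sub>R (c *\<^sub>C (x::'a::complex_inner))"
  by (simp add: scaleR_eq_scaleC scaleC_scaleC mult.commute)

lemma scaleC_op_id_apply: "scaleC_op c id_blinfun x = c *\<^sub>C x"
  by (simp add: scaleC_op.rep_eq)

lemma scaleC_op_eq_compose: "scaleC_op c T = scaleC_op c id_blinfun o\<^sub>L T"
  by (rule blinfun_eqI) (simp add: scaleC_op.rep_eq)

lemma scaleC_op_minus_one: "scaleC_op (-1) T = - T"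
proof (rule blinfun_eqI)
  fix x
  show "scaleC_op (-1) T x = (- T) x"
    using scaleR_eq_scaleC[of "-1" "T x"] by (simp add: scaleC_op.rep_eq uminus_blinfun.rep_eq)
qed

lemma complex_linear_compose: "complex_linear T \<Longrightarrow> complex_linear S \<Longrightarrow> complex_linear (T o\<^sub>L S)"
  by (simp add: complex_linear_def)

lemma complex_linear_scaleC_op_id: "complex_linear (scaleC_op c id_blinfun)"
  by (simp add: complex_linear_def scaleC_op_id_apply scaleC_scaleC mult.commute)

lemma complex_linear_rank_one_proj: "complex_linear (rank_one_proj u)"
  by (simp add: complex_linear_def rank_one_proj.rep_eq cinner_scaleC_left scaleC_scaleC)

lemma compact_operators_linear: "T \<in> compact_operators \<Longrightarrow> complex_linear T"
  by (simp add: compact_operators_def complex_linear_def)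

text \<open>A closed subset of a compact set is compact, so it is enough to trap the image of the unit ball
  in some compact set. The closure properties below then reduce to building such sets.\<close>

lemma compact_operatorsI:
  assumes "complex_linear T" "compact K" "\<And>x. norm x \<le> 1 \<Longrightarrow> T x \<in> K"
  shows "T \<in> compact_operators"
proof -
  have "closure (T ` cball 0 1) \<subseteq> K"
    using assms(3) by (intro closure_minimal compact_imp_closed[OF assms(2)]) auto
  then have "K \<inter> closure (T ` cball 0 1) = closure (T ` cball 0 1)"
    by blast
  then have "compact (closure (T ` cball 0 1))"
    using compact_Int_closed[OF assms(2) closed_closure, of "T ` cball 0 1"] by simp
  then show ?thesis
    using assms(1) by (simp add: compact_operators_def complex_linear_def)
qed

text \<open>By homogeneity, the image of a ball of any radius is trapped in a dilate of the compact set for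
  the unit ball; composition with an operator on the right needs radii other than 1.\<close>

lemma compact_operatorsE:
  assumes "T \<in> compact_operators"
  obtains K where "compact K" "\<And>x. norm x \<le> r \<Longrightarrow> T x \<in> K"
proof
  define R where "R = max r 1"
  have R: "R > 0" "r \<le> R" by (auto simp: R_def)
  let ?K = "(\<lambda>y. R *\<^sub>R y) ` closure (T ` cball 0 1)"
  show "compact ?K"
    using assms by (intro compact_continuous_image continuous_intros) (simp add: compact_operators_def)
  show "T x \<in> ?K" if "norm x \<le> r" for x
  proof
    show "T x = R *\<^sub>R T (x /\<^sub>R R)" using R by (simp add: blinfun.scaleR_right)
    have "norm (x /\<^sub>R R) \<le> 1" using R that by (simp add: field_simps)
    then have "T (x /\<^sub>R R) \<in> T ` cball 0 1" by (intro imageI) simp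
    then show "T (x /\<^sub>R R) \<in> closure (T ` cball 0 1)"
      by (rule subsetD[OF closure_subset])
  qed
qed

lemma compact_operators_add:
  assumes "S \<in> compact_operators" "T \<in> compact_operators"
  shows "S + T \<in> compact_operators"
proof -
  obtain K where K: "compact K" "\<And>x. norm x \<le> 1 \<Longrightarrow> S x \<in> K"
    using compact_operatorsE[OF assms(1)] by blast
  obtain L where L: "compact L" "\<And>x. norm x \<le> 1 \<Longrightarrow> T x \<in> L"
    using compact_operatorsE[OF assms(2)] by blast
  show ?thesis
  proof (rule compact_operatorsI)
    show "complex_linear (S + T)"
      using assms[THEN compact_operators_linear]
      by (simp add: complex_linear_def blinfun.add_left scaleC_add_right)
    show "compact {x + y |x y. x \<in> K \<and> y \<in> L}"
      using K(1) L(1) by (rule compact_sums)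
    show "(S + T) x \<in> {x + y |x y. x \<in> K \<and> y \<in> L}" if "norm x \<le> 1" for x
      using K(2)[OF that] L(2)[OF that] by (auto simp: blinfun.add_left)
  qed
qed

lemma compact_operators_compose_left:
  assumes "complex_linear S" "T \<in> compact_operators"
  shows "S o\<^sub>L T \<in> compact_operators"
proof -
  obtain K where K: "compact K" "\<And>x. norm x \<le> 1 \<Longrightarrow> T x \<in> K"
    using compact_operatorsE[OF assms(2)] by blast
  show ?thesis
  proof (rule compact_operatorsI)
    show "complex_linear (S o\<^sub>L T)"
      by (rule complex_linear_compose[OF assms(1) compact_operators_linear[OF assms(2)]])
    show "compact (S ` K)"
      by (intro compact_continuous_image K(1) continuous_intros)
  qed (simp add: K(2))
qed

lemma compact_operators_compose_right:
  assumes "T \<in> compact_operators" "complex_linear S"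
  shows "T o\<^sub>L S \<in> compact_operators"
proof -
  obtain K where K: "compact K" "\<And>x. norm x \<le> norm S \<Longrightarrow> T x \<in> K"
    using compact_operatorsE[OF assms(1)] by blast
  show ?thesis
  proof (rule compact_operatorsI)
    show "complex_linear (T o\<^sub>L S)"
      by (rule complex_linear_compose[OF compact_operators_linear[OF assms(1)] assms(2)])
    show "(T o\<^sub>L S) x \<in> K" if "norm x \<le> 1" for x
      using norm_blinfun[of S x] mult_left_mono[OF that, of "norm S"] by (auto intro!: K(2))
  qed (rule K(1))
qed

lemma compact_operators_scaleC: "T \<in> compact_operators \<Longrightarrow> scaleC_op c T \<in> compact_operators"
  using compact_operators_compose_left[OF complex_linear_scaleC_op_id, of T c]
  by (simp flip: scaleC_op_eq_compose)

lemma compact_operators_scaleR: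
  assumes "T \<in> compact_operators"
  shows "r *\<^sub>R T \<in> compact_operators"
proof -
  have "r *\<^sub>R T = scaleC_op (complex_of_real r) T"
    by (rule blinfun_eqI) (simp add: scaleC_op.rep_eq scaleR_blinfun.rep_eq scaleR_eq_scaleC)
  then show ?thesis
    using compact_operators_scaleC[OF assms] by simp
qed

lemma zero_compact_operator: "0 \<in> compact_operators"
  by (rule compact_operatorsI[of _ "{0}"]) (simp_all add: complex_linear_def)

lemma rank_one_proj_compact: "rank_one_proj u \<in> compact_operators"
proof (rule compact_operatorsI[OF complex_linear_rank_one_proj])
  have "bounded_linear (\<lambda>c. c *\<^sub>C u)"
    by (rule bounded_linear_intro[where K = "norm u"])
      (simp_all add: scaleC_add_left scaleR_eq_scaleC scaleC_scaleC norm_scaleC scaleR_conv_of_real)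
  then show "compact ((\<lambda>c. c *\<^sub>C u) ` cball 0 (norm u))"
    by (intro compact_continuous_image linear_continuous_on compact_cball)
  show "rank_one_proj u x \<in> (\<lambda>c. c *\<^sub>C u) ` cball 0 (norm u)" if "norm x \<le> 1" for x
    using cmod_cinner_le[of x u] mult_right_mono[OF that, of "norm u"]
    by (auto simp: rank_one_proj.rep_eq)
qed

section \<open>Diagonal operators\<close>

lemma norm_eq_1_if_cinner_eq_1: "cinner x x = 1 \<Longrightarrow> norm (x::'a::complex_inner) = 1"
  by (simp add: norm_eq_sqrt_inner inner_eq_Re_cinner)

lemma norm_rank_one_proj_le:
  assumes "norm u \<le> 1"
  shows "norm (rank_one_proj u) \<le> 1"
proof (rule norm_blinfun_bound)
  fix x
  have "cmod (cinner x u) \<le> norm x * 1"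
    by (rule order_trans[OF cmod_cinner_le mult_left_mono[OF assms norm_ge_zero]])
  then have "cmod (cinner x u) * norm u \<le> (norm x * 1) * 1"
    using assms by (rule mult_mono) simp_all
  then show "norm (rank_one_proj u x) \<le> 1 * norm x"
    by (simp add: rank_one_proj.rep_eq norm_scaleC)
qed simp

lemma diagonal_op_summable:
  fixes e :: "'i \<Rightarrow> 'h::complex_hilbert"
  assumes "\<And>i. i \<in> I \<Longrightarrow> norm (e i) \<le> 1" "(\<lambda>i. \<bar>c i\<bar>) summable_on I"
  shows "(\<lambda>i. norm (c i *\<^sub>R rank_one_proj (e i))) summable_on I"
proof (rule summable_on_comparison_test[OF assms(2)])
  show "norm (c i *\<^sub>R rank_one_proj (e i)) \<le> \<bar>c i\<bar>" if "i \<in> I" for i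
    using mult_left_mono[OF norm_rank_one_proj_le[OF assms(1)[OF that]], of "\<bar>c i\<bar>"] by simp
qed simp

lemma norm_diagonal_op_le:
  fixes e :: "'i \<Rightarrow> 'h::complex_hilbert"
  assumes e: "\<And>i. i \<in> I \<Longrightarrow> norm (e i) \<le> 1" and c: "(\<lambda>i. \<bar>c i\<bar>) summable_on I"
  shows "norm (\<Sum>\<^sub>\<infinity>i\<in>I. c i *\<^sub>R rank_one_proj (e i)) \<le> (\<Sum>\<^sub>\<infinity>i\<in>I. \<bar>c i\<bar>)"
proof -
  have "norm (\<Sum>\<^sub>\<infinity>i\<in>I. c i *\<^sub>R rank_one_proj (e i)) \<le> (\<Sum>\<^sub>\<infinity>i\<in>I. norm (c i *\<^sub>R rank_one_proj (e i)))"
    by (rule norm_infsum_bound[OF diagonal_op_summable[OF assms]])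
  also have "\<dots> \<le> (\<Sum>\<^sub>\<infinity>i\<in>I. \<bar>c i\<bar>)"
  proof (rule infsum_mono[OF diagonal_op_summable[OF assms] c])
    show "norm (c i *\<^sub>R rank_one_proj (e i)) \<le> \<bar>c i\<bar>" if "i \<in> I" for i
      using mult_left_mono[OF norm_rank_one_proj_le[OF e[OF that]], of "\<bar>c i\<bar>"] by simp
  qed
  finally show ?thesis .
qed

text \<open>Evaluation at \<open>x\<close> is bounded and linear in the operator, so it passes through the
  series; the properties of the sum are then read off pointwise.\<close>

lemma diagonal_op_apply:
  fixes e :: "'i \<Rightarrow> 'h::complex_hilbert"
  assumes "\<And>i. i \<in> I \<Longrightarrow> norm (e i) \<le> 1" "(\<lambda>i. \<bar>c i\<bar>) summable_on I"
  shows "((\<lambda>i. c i *\<^sub>R rank_one_proj (e i) x) has_sum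
    (\<Sum>\<^sub>\<infinity>i\<in>I. c i *\<^sub>R rank_one_proj (e i)) x) I"
proof -
  have "((\<lambda>i. c i *\<^sub>R rank_one_proj (e i)) has_sum (\<Sum>\<^sub>\<infinity>i\<in>I. c i *\<^sub>R rank_one_proj (e i))) I"
    by (rule has_sum_infsum[OF abs_summable_summable[OF diagonal_op_summable[OF assms]]])
  from has_sum_bounded_linear[OF blinfun.bounded_linear_left[of x] this]
  show ?thesis by (simp add: o_def blinfun.scaleR_left)
qed

lemma complex_linear_diagonal_op:
  fixes e :: "'i \<Rightarrow> 'h::complex_hilbert"
  assumes "\<And>i. i \<in> I \<Longrightarrow> norm (e i) \<le> 1" "(\<lambda>i. \<bar>c i\<bar>) summable_on I"
  shows "complex_linear (\<Sum>\<^sub>\<infinity>i\<in>I. c i *\<^sub>R rank_one_proj (e i))"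
  unfolding complex_linear_def
proof (intro allI)
  fix z x
  let ?D = "\<Sum>\<^sub>\<infinity>i\<in>I. c i *\<^sub>R rank_one_proj (e i)"
  have "((\<lambda>i. z *\<^sub>C (c i *\<^sub>R rank_one_proj (e i) x)) has_sum z *\<^sub>C ?D x) I"
    using has_sum_bounded_linear[OF blinfun.bounded_linear_right[of "scaleC_op z id_blinfun"]
        diagonal_op_apply[OF assms]]
    by (simp add: o_def scaleC_op_id_apply)
  moreover have "((\<lambda>i. c i *\<^sub>R rank_one_proj (e i) (z *\<^sub>C x)) has_sum ?D (z *\<^sub>C x)) I"
    by (rule diagonal_op_apply[OF assms])
  moreover have "c i *\<^sub>R rank_one_proj (e i) (z *\<^sub>C x) = z *\<^sub>C (c i *\<^sub>R rank_one_proj (e i) x)" for i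
    using complex_linear_rank_one_proj[of "e i"]
    by (simp add: complex_linear_def scaleC_scaleR_commute)
  ultimately show "?D (z *\<^sub>C x) = z *\<^sub>C ?D x"
    using has_sum_unique by fastforce
qed

lemma diagonal_op_apply_basis:
  fixes e :: "'i \<Rightarrow> 'h::complex_hilbert"
  assumes c: "(\<lambda>i. \<bar>c i\<bar>) summable_on I"
    and e: "\<And>i j. i \<in> I \<Longrightarrow> j \<in> I \<Longrightarrow> cinner (e i) (e j) = (if i = j then 1 else 0)"
    and j: "j \<in> I"
  shows "(\<Sum>\<^sub>\<infinity>i\<in>I. c i *\<^sub>R rank_one_proj (e i)) (e j) = c j *\<^sub>R e j"
proof -
  let ?D = "\<Sum>\<^sub>\<infinity>i\<in>I. c i *\<^sub>R rank_one_proj (e i)"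
  have n: "norm (e i) \<le> 1" if "i \<in> I" for i
    using e[OF that that] by (simp add: norm_eq_1_if_cinner_eq_1)
  have "((\<lambda>i. c i *\<^sub>R rank_one_proj (e i) (e j)) has_sum ?D (e j)) I"
    by (rule diagonal_op_apply[OF n c])
  moreover have "((\<lambda>i. c i *\<^sub>R rank_one_proj (e i) (e j)) has_sum c j *\<^sub>R e j) I"
  proof (rule has_sum_finite_neutralI[of "{j}"])
    show "c i *\<^sub>R rank_one_proj (e i) (e j) = 0" if "i \<in> I - {j}" for i
      using that e[OF j, of i] by (auto simp: rank_one_proj.rep_eq)
  qed (use j e[OF j j] in \<open>auto simp: rank_one_proj.rep_eq scaleC_one\<close>)
  ultimately show ?thesis by (rule has_sum_unique)
qed

lemma compose_rank_one_proj_eigenvector: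
  assumes "complex_linear T" "T u = r *\<^sub>R u"
  shows "T o\<^sub>L rank_one_proj u = r *\<^sub>R rank_one_proj u"
  using assms
  by (intro blinfun_eqI)
    (simp add: complex_linear_def rank_one_proj.rep_eq blinfun.scaleR_left scaleC_scaleR_commute)

text \<open>The kernel is a closed complex subspace, and the span of the basis is dense.\<close>

lemma complex_linear_eq_zero_if_zero_on_basis:
  assumes T: "complex_linear T" and e: "orthonormal_basis e I" and 0: "\<And>i. i \<in> I \<Longrightarrow> T (e i) = 0"
  shows "T = 0"
proof (rule blinfun_eqI)
  fix x
  have "complex_vector.subspace {x. T x = 0}"
    using T by (auto simp: complex_vector.subspace_def complex_linear_def blinfun.add_right)
  then have "cspan (e ` I) \<subseteq> {x. T x = 0}"
    using 0 by (intro complex_vector.span_minimal) auto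
  moreover have "closed {x. T x = 0}"
    by (intro closed_Collect_eq continuous_intros)
  ultimately have "closure (cspan (e ` I)) \<subseteq> {x. T x = 0}"
    by (rule closure_minimal)
  then show "T x = blinfun_apply 0 x"
    using e by (auto simp: orthonormal_basis_def)
qed

section \<open>Ideals of functions that a discontinuous multiplier keeps continuous\<close>

lemma elems_cont_compact_ops_iff:
  "a \<in> elems (cont_compact_ops X) \<longleftrightarrow>
    continuous_on X a \<and> (\<forall>s\<in>X. a s \<in> compact_operators) \<and> (\<forall>s. s \<notin> X \<longrightarrow> a s = 0)"
  by (simp add: cont_compact_ops_def)

lemma elems_add:
  assumes "a \<in> elems (cont_compact_ops X)" "b \<in> elems (cont_compact_ops X)"
  shows "(\<lambda>s. a s + b s) \<in> elems (cont_compact_ops X)"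
  using assms by (auto simp: elems_cont_compact_ops_iff intro!: continuous_intros compact_operators_add)

lemma elems_scale:
  assumes "a \<in> elems (cont_compact_ops X)"
  shows "(\<lambda>s. scaleC_op c (a s)) \<in> elems (cont_compact_ops X)"
proof -
  have "continuous_on X (\<lambda>s. scaleC_op c id_blinfun o\<^sub>L a s)"
    using assms by (intro bounded_bilinear.continuous_on[OF bounded_bilinear_blinfun_compose]
      continuous_intros) (simp add: elems_cont_compact_ops_iff)
  then have "continuous_on X (\<lambda>s. scaleC_op c (a s))"
    by (simp flip: scaleC_op_eq_compose)
  moreover have "scaleC_op c 0 = 0"
    by (rule blinfun_eqI) (simp add: scaleC_op.rep_eq)
  ultimately show ?thesis
    using assms by (auto simp: elems_cont_compact_ops_iff intro!: compact_operators_scaleC)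
qed

lemma elems_mult:
  assumes "a \<in> elems (cont_compact_ops X)" "b \<in> elems (cont_compact_ops X)"
  shows "(\<lambda>s. a s o\<^sub>L b s) \<in> elems (cont_compact_ops X)"
  using assms
  by (auto simp: elems_cont_compact_ops_iff intro!: compact_operators_compose_left
    compact_operators_linear bounded_bilinear.continuous_on[OF bounded_bilinear_blinfun_compose])

lemma mult_elems_iff_continuous:
  assumes "\<And>s. s \<in> X \<Longrightarrow> complex_linear (f s)" "x \<in> elems (cont_compact_ops X)"
  shows "(\<lambda>s. f s o\<^sub>L x s) \<in> elems (cont_compact_ops X) \<longleftrightarrow> continuous_on X (\<lambda>s. f s o\<^sub>L x s)"
  using assms by (auto simp: elems_cont_compact_ops_iff intro!: compact_operators_compose_left)

text \<open>Compactness of \<open>X\<close> makes the supremum that defines the norm a genuine upper bound.\<close>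

lemma norm_diff_le_norm_of:
  assumes "compact X" "a \<in> elems (cont_compact_ops X)" "x \<in> elems (cont_compact_ops X)" "s \<in> X"
  shows "norm (a s - x s) \<le> norm_of (cont_compact_ops X)
    (add_of (cont_compact_ops X) a (scale_of (cont_compact_ops X) (-1) x))"
proof -
  have "compact ((\<lambda>s. norm (a s - x s)) ` X)"
    using assms
    by (intro compact_continuous_image continuous_intros) (auto simp: elems_cont_compact_ops_iff)
  then have "bdd_above ((\<lambda>s. norm (a s - x s)) ` X)"
    by (intro bounded_imp_bdd_above compact_imp_bounded)
  from cSUP_upper[OF assms(4) this] show ?thesis
    by (simp add: cont_compact_ops_def scaleC_op_minus_one)
qed

text \<open>Boundedness of \<open>f\<close> is what makes the ideal closed: if \<open>x\<^sub>n\<close> tends to \<open>a\<close> uniformly, then so does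
  \<open>f x\<^sub>n\<close> to \<open>f a\<close>, and a uniform limit of continuous functions is continuous.\<close>

lemma multiplier_closed_right_ideal:
  fixes f :: "'x::topological_space \<Rightarrow> 'h::complex_hilbert \<Rightarrow>\<^sub>L 'h"
  assumes X: "compact X" and lin: "\<And>s. s \<in> X \<Longrightarrow> complex_linear (f s)"
    and B: "\<And>s. s \<in> X \<Longrightarrow> norm (f s) \<le> B"
  defines "A \<equiv> cont_compact_ops X"
  shows "closed_right_ideal A {x \<in> elems A. mult_of A f x \<in> elems A}"
    (is "closed_right_ideal A ?J")
  unfolding closed_right_ideal_def
proof
  have ops: "add_of A = (\<lambda>a b s. a s + b s)" "scale_of A = (\<lambda>c a s. scaleC_op c (a s))"
    "mult_of A = (\<lambda>a b s. a s o\<^sub>L b s)" "zero_of A = (\<lambda>s. 0)"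
    by (simp_all add: A_def cont_compact_ops_def)
  have elems: "\<And>a b. a \<in> elems A \<Longrightarrow> b \<in> elems A \<Longrightarrow> (\<lambda>s. a s + b s) \<in> elems A"
    "\<And>a b. a \<in> elems A \<Longrightarrow> b \<in> elems A \<Longrightarrow> (\<lambda>s. a s o\<^sub>L b s) \<in> elems A"
    "\<And>c a. a \<in> elems A \<Longrightarrow> (\<lambda>s. scaleC_op c (a s)) \<in> elems A"
    "\<And>a. a \<in> elems A \<Longrightarrow> continuous_on X a"
    unfolding A_def by (fact elems_add elems_mult elems_scale | simp add: elems_cont_compact_ops_iff)+
  show "right_ideal A ?J"
    unfolding right_ideal_def
  proof (intro conjI ballI allI)
    have "(\<lambda>s. 0) \<in> elems A"
      by (simp add: A_def elems_cont_compact_ops_iff zero_compact_operator)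
    then show "zero_of A \<in> ?J" by (simp add: ops)
  next
    fix x y assume xy: "x \<in> ?J" "y \<in> ?J"
    have "mult_of A f (add_of A x y) = (\<lambda>s. (f s o\<^sub>L x s) + (f s o\<^sub>L y s))"
      by (simp add: ops bounded_bilinear.add_right[OF bounded_bilinear_blinfun_compose])
    then show "add_of A x y \<in> ?J"
      using xy by (simp add: ops elems)
  next
    fix c x assume x: "x \<in> ?J"
    have "mult_of A f (scale_of A c x) s = scaleC_op c (f s o\<^sub>L x s)" for s
    proof (cases "s \<in> X")
      case True
      then show ?thesis
        using lin[OF True]
        by (intro blinfun_eqI) (simp add: ops scaleC_op.rep_eq complex_linear_def)
    next
      case False
      then have "x s = 0" using x by (simp add: A_def elems_cont_compact_ops_iff)
      then show ?thesis
        by (intro blinfun_eqI) (simp add: ops scaleC_op.rep_eq)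
    qed
    then have "mult_of A f (scale_of A c x) = (\<lambda>s. scaleC_op c (f s o\<^sub>L x s))" ..
    then show "scale_of A c x \<in> ?J"
      using x by (simp add: ops elems)
  next
    fix x a assume x: "x \<in> ?J" and a: "a \<in> elems A"
    have "mult_of A f (mult_of A x a) = mult_of A (mult_of A f x) a"
      by (intro ext blinfun_eqI) (simp add: ops)
    then show "mult_of A x a \<in> ?J"
      using x a by (simp add: ops elems)
  qed auto
  show "norm_closed A ?J"
    unfolding norm_closed_def
  proof (intro ballI impI)
    fix a assume a: "a \<in> elems A"
      and appr: "\<forall>\<epsilon>>0. \<exists>x\<in>?J. norm_of A (add_of A a (scale_of A (-1) x)) < \<epsilon>"
    have "\<forall>n. \<exists>x. x \<in> ?J \<and> norm_of A (add_of A a (scale_of A (-1) x)) < inverse (real (Suc n))"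
    proof
      fix n
      have "inverse (real (Suc n)) > 0" by simp
      with appr show "\<exists>x. x \<in> ?J \<and> norm_of A (add_of A a (scale_of A (-1) x)) < inverse (real (Suc n))"
        by blast
    qed
    from choice[OF this] obtain x where x: "\<And>n. x n \<in> ?J"
      "\<And>n. norm_of A (add_of A a (scale_of A (-1) (x n))) < inverse (real (Suc n))"
      by blast
    have near: "norm ((f s o\<^sub>L x n s) - (f s o\<^sub>L a s)) \<le> \<bar>B\<bar> * inverse (real (Suc n))" if "s \<in> X" for n s
    proof -
      have "norm (x n s - a s) \<le> inverse (real (Suc n))"
        using norm_diff_le_norm_of[OF X _ _ that, of a "x n"] x[of n] a
        by (simp add: A_def norm_minus_commute)
      moreover have "norm (f s o\<^sub>L (x n s - a s)) \<le> norm (f s) * norm (x n s - a s)"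
        by (rule norm_blinfun_compose)
      moreover have "norm (f s) \<le> \<bar>B\<bar>" using B[OF that] by simp
      ultimately have "norm (f s o\<^sub>L (x n s - a s)) \<le> \<bar>B\<bar> * inverse (real (Suc n))"
        by (meson abs_ge_zero mult_mono norm_ge_zero order_trans)
      then show ?thesis
        by (simp add: bounded_bilinear.diff_right[OF bounded_bilinear_blinfun_compose])
    qed
    have "(\<lambda>n. \<bar>B\<bar> * inverse (real (Suc n))) \<longlonglongrightarrow> 0"
      using tendsto_mult_right_zero[OF LIMSEQ_inverse_real_of_nat] by simp
    then have "uniform_limit X (\<lambda>n s. f s o\<^sub>L x n s) (\<lambda>s. f s o\<^sub>L a s) sequentially"
      unfolding uniform_limit_iff
    proof (intro allI impI)
      fix \<epsilon> :: real assume "\<epsilon> > 0"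
      then have "\<forall>\<^sub>F n in sequentially. \<bar>B\<bar> * inverse (real (Suc n)) < \<epsilon>"
        using \<open>_ \<longlonglongrightarrow> 0\<close> by (rule order_tendstoD(2)[rotated])
      then show "\<forall>\<^sub>F n in sequentially. \<forall>s\<in>X. dist (f s o\<^sub>L x n s) (f s o\<^sub>L a s) < \<epsilon>"
      proof eventually_elim
        case (elim n)
        show ?case
          unfolding dist_norm using le_less_trans[OF near elim] by blast
      qed
    qed
    moreover have "continuous_on X (\<lambda>s. f s o\<^sub>L x n s)" for n
      using x(1)[of n] by (simp add: ops elems)
    ultimately have "continuous_on X (\<lambda>s. f s o\<^sub>L a s)"
      by (intro uniform_limit_theorem) auto
    then show "a \<in> ?J"
      using a mult_elems_iff_continuous[of X f a, folded A_def, OF lin] by (simp add: ops)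
  qed
qed

section \<open>Thickness\<close>

text \<open>The interval has no isolated points, so continuity determines the value at \<open>p\<close> from the
  values elsewhere.\<close>

lemma continuous_zero_off_point:
  fixes g :: "real \<Rightarrow> 'b::real_normed_vector"
  assumes "continuous_on {0..1} g" "\<And>s. s \<in> {0..1} \<Longrightarrow> s \<noteq> p \<Longrightarrow> g s = 0" "s \<in> {0..1}"
  shows "g s = 0"
proof (cases "s = p")
  case True
  have "s islimpt {0..1}"
    using assms(3) by (intro connected_imp_perfect) (auto intro: exI[of _ "0::real"])
  then have "at s within {0..1} \<noteq> bot" by (simp add: trivial_limit_within)
  moreover have "(g \<longlongrightarrow> g s) (at s within {0..1})"
    using assms by (auto simp: continuous_on_def)
  moreover have "(g \<longlongrightarrow> 0) (at s within {0..1})"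
    by (rule tendsto_eventually) (use assms(2) True in \<open>auto simp: eventually_at_filter\<close>)
  ultimately show ?thesis by (rule tendsto_unique)
qed (use assms in auto)

theorem lemma2p3:
  fixes e :: "nat \<Rightarrow> 'h::complex_hilbert"
    and t :: "nat \<Rightarrow> real"
    and f :: "real \<Rightarrow> 'h \<Rightarrow>\<^sub>L 'h"
  defines "A \<equiv> cont_compact_ops {0..1::real} :: (real \<Rightarrow> 'h \<Rightarrow>\<^sub>L 'h) normed_alg"
  defines "f \<equiv> \<lambda>s. \<Sum>\<^sub>\<infinity>i\<in>{1..}. ((1 / 2 ^ i) * indicat_real {0..t i} s) *\<^sub>R rank_one_proj (e i)"
  defines "J \<equiv> {x \<in> elems A. mult_of A f x \<in> elems A}"
  assumes "orthonormal_basis e {1..}"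
    and "t ` {1..} \<subseteq> {0..1}"
    and "{0..1} \<subseteq> closure (t ` {1..})"
  shows "thick A J"
proof -
  have mult: "mult_of A = (\<lambda>a b s. a s o\<^sub>L b s)"
    by (simp add: A_def cont_compact_ops_def)
  define c where "c s i = (1 / 2 ^ i) * indicat_real {0..t i} s" for s i
  have f: "f s = (\<Sum>\<^sub>\<infinity>i\<in>{1..}. c s i *\<^sub>R rank_one_proj (e i))" for s
    by (simp add: f_def c_def)
  have e: "cinner (e i) (e j) = (if i = j then 1 else 0)" if "i \<in> {1..}" "j \<in> {1..}" for i j
    using assms(4) that unfolding orthonormal_basis_def by blast
  have norm_e: "norm (e i) \<le> 1" if "i \<in> {1..}" for i
    using e[OF that that] by (simp add: norm_eq_1_if_cinner_eq_1)
  have "(\<lambda>i. (1/2::real) ^ i) summable_on UNIV"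
    by (intro norm_summable_imp_summable_on) (simp add: summable_geometric norm_power)
  then have geometric: "(\<lambda>i. (1/2::real) ^ i) summable_on {1..}"
    by (rule summable_on_subset_banach) simp
  have c_le: "\<bar>c s i\<bar> \<le> (1/2) ^ i" for s i
    by (auto simp: c_def power_divide split: split_indicator)
  have c_summable: "(\<lambda>i. \<bar>c s i\<bar>) summable_on {1..}" for s
    by (rule summable_on_comparison_test[OF geometric]) (use c_le in auto)
  have f_linear: "complex_linear (f s)" for s
    unfolding f by (rule complex_linear_diagonal_op[OF norm_e c_summable])
  have f_bounded: "norm (f s) \<le> (\<Sum>\<^sub>\<infinity>i\<in>{1..}. (1/2) ^ i)" for s
    unfolding f
    by (rule order_trans[OF norm_diagonal_op_le[OF norm_e c_summable]
          infsum_mono[OF c_summable geometric c_le]])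
  have "closed_right_ideal A J"
    unfolding A_def J_def
    using f_linear f_bounded by (intro multiplier_closed_right_ideal compact_Icc)
  moreover have "a = zero_of A"
    if a: "a \<in> elems A" and aJ: "\<forall>x\<in>J. mult_of A a x = zero_of A" for a
  proof -
    have a_zero: "a s (e i) = 0" if i: "i \<in> {1..}" and s: "s \<in> {0..1}" for i s
    proof -
      \<comment> \<open>The factor \<open>s - t i\<close> removes the only jump of the \<open>i\<close>-th diagonal entry of \<open>f\<close>; the
        indicator is there because functions are extended by \<open>0\<close> outside the interval.\<close>
      define x where "x s = (indicat_real {0..1} s * (s - t i)) *\<^sub>R rank_one_proj (e i)" for s
      have "continuous_on {0..1} x \<longleftrightarrow> continuous_on {0..1} (\<lambda>s. (s - t i) *\<^sub>R rank_one_proj (e i))"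
        by (rule continuous_on_cong) (auto simp: x_def)
      then have x: "x \<in> elems A"
        by (auto simp: A_def elems_cont_compact_ops_iff x_def
            intro!: continuous_intros compact_operators_scaleR rank_one_proj_compact)
      have "f s o\<^sub>L x s = ((1 / 2 ^ i) * min (s - t i) 0) *\<^sub>R rank_one_proj (e i)"
        if "s \<in> {0..1}" for s
      proof -
        \<comment> \<open>The coefficient is \<open>1 / 2 ^ i\<close> for \<open>s \<le> t i\<close> and \<open>0\<close> afterwards, so multiplied by
          \<open>s - t i\<close> it yields the minimum.\<close>
        have "f s o\<^sub>L rank_one_proj (e i) = c s i *\<^sub>R rank_one_proj (e i)"
          using f_linear diagonal_op_apply_basis[OF c_summable[of s] e i]
          by (intro compose_rank_one_proj_eigenvector) (simp_all add: f)
        then show ?thesis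
          using that
          by (auto simp: x_def c_def min_def indicator_def
              bounded_bilinear.scaleR_right[OF bounded_bilinear_blinfun_compose])
      qed
      then have "continuous_on {0..1} (\<lambda>s. f s o\<^sub>L x s) \<longleftrightarrow>
          continuous_on {0..1} (\<lambda>s. ((1 / 2 ^ i) * min (s - t i) 0) *\<^sub>R rank_one_proj (e i))"
        by (intro continuous_on_cong) auto
      then have "continuous_on {0..1} (\<lambda>s. f s o\<^sub>L x s)"
        by (auto intro!: continuous_intros)
      then have "x \<in> J"
        using x mult_elems_iff_continuous[of "{0..1}" f x, folded A_def, OF f_linear]
        by (simp add: J_def mult)
      with aJ have "mult_of A a x = zero_of A" by blast
      then have ax: "a s o\<^sub>L x s = 0" for s
        by (simp add: A_def cont_compact_ops_def fun_eq_iff)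
      have "a s (e i) = 0" if "s \<in> {0..1}" "s \<noteq> t i" for s
      proof -
        have "(a s o\<^sub>L x s) (e i) = (s - t i) *\<^sub>R a s (e i)"
          using that e[OF i i]
          by (simp add: x_def rank_one_proj.rep_eq blinfun.scaleR_left blinfun.scaleR_right scaleC_one)
        then show ?thesis using ax that by simp
      qed
      moreover have "continuous_on {0..1} (\<lambda>s. a s (e i))"
        using a by (intro continuous_intros) (simp add: A_def elems_cont_compact_ops_iff)
      ultimately show ?thesis
        using s by (intro continuous_zero_off_point[of "\<lambda>s. a s (e i)" "t i" s])
    qed
    have "a s = 0" for s
    proof (cases "s \<in> {0..1}")
      case True
      then have "complex_linear (a s)"
        using a by (auto simp: A_def elems_cont_compact_ops_iff intro: compact_operators_linear)
      then show ?thesis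
        using assms(4) a_zero[OF _ True] by (rule complex_linear_eq_zero_if_zero_on_basis)
    qed (use a in \<open>simp add: A_def elems_cont_compact_ops_iff\<close>)
    then show ?thesis by (auto simp: A_def cont_compact_ops_def)
  qed
  ultimately show ?thesis by (simp add: thick_def)
qed

end
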